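(* Let $F\in\mathcal F_1(I)$ be strictly increasing. Then every square decreasing iterative root $f\in\mathcal F(I)$ of $F$ on $I\setminus J(F)$ (i.e. strictly decreasing $f\in\mathcal F(I)$ with $f^2(x)=F(x)$ for all $x\in I\setminus J(F)$) is, on $I\setminus J(F)$, an extension of a strictly decreasing square iterative root of $F$ on the subintervals in $\Lambda(F)$; that is, with $D:=\bigcup_{J\in\Lambda(F)}J$, one has $f(D)\subset D$, and $f|_D$ is a strictly decreasing single-valued self-map of $D$ with $(f|_D)^2=F|_D$.
   Context: Let $I=[a,b]\subset\mathbb R$, $a<b$. A multifunction $F:I\to 2^I$ assigns to each $x\in I$ a nonempty subset $F(x)\subset I$ (singletons are identified with their elements); $F(A)=\bigcup_{x\in A}F(x)$, $(G\circ F)(x)=G(F(x))$, $F^0(x)=\{x\}$, $F^n=F\circ F^{n-1}$. $F$ is upper semi-continuous (usc) at $x_0\in I$ if for every open $V\subset\mathbb R$ with $F(x_0)\subset V$ there is a neighborhood $U$ of $x_0$ such that $F(x)\subset V$ for all $x\in U\cap I$; usc means usc at every point. $F$ is strictly increasing (resp. strictly decreasing) if $\max F(x)<\min F(y)$ (resp. $\min F(x)>\max F(y)$) whenever $x,y\in I$, $x<y$; strictly monotone means one of these. $\mathcal F(I)$ is the class of strictly monotone usc multifunctions $I\to 2^I$. A jump of $F$ is a point $x_0\in I$ with $\#F(x_0)\ge 2$; $J(F)$ is the set of jumps. For $F\in\mathcal F(I)$ with finitely many jumps, the intensity $\zeta(F)$ is the least integer $k\ge 0$ with $\#J(F^k)=\#J(F^{k+1})$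 (and $+\infty$ if there is none). $\mathcal F_1(I)$ is the set of $F\in\mathcal F(I)$ with finitely many jumps and $\zeta(F)=1$. For $F\in\mathcal F_1(I)$ write $J(F)=\{c_1,\dots,c_m\}$ with the standing convention $a=:c_0<c_1<\dots<c_m<c_{m+1}:=b$, put $I_i:=(c_i,c_{i+1})$ and $I(F):=\{I_i: i=0,\dots,m\}$. For strictly increasing $F\in\mathcal F_1(I)$, $\Lambda(F)$ is the set of all $J\in I(F)$ with $F(J)\subset J$. *)

theory Defs
  imports Complex_Main "HOL-Library.Extended_Nat"
begin

text \<open>
  A multifunction on \<open>I\<close> is a total function of type \<open>real \<Rightarrow> real set\<close>; only its values at
  points of \<open>I\<close> are ever constrained or used.
\<close>

definition multifunction :: "real set \<Rightarrow> (real \<Rightarrow> real set) \<Rightarrow> bool" where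
  "multifunction I F \<longleftrightarrow> (\<forall>x\<in>I. F x \<noteq> {} \<and> F x \<subseteq> I)"

definition mimage :: "(real \<Rightarrow> real set) \<Rightarrow> real set \<Rightarrow> real set" where
  "mimage F A = (\<Union>x\<in>A. F x)"

definition mcomp :: "(real \<Rightarrow> real set) \<Rightarrow> (real \<Rightarrow> real set) \<Rightarrow> real \<Rightarrow> real set" where
  "mcomp G F = (\<lambda>x. mimage G (F x))"

primrec mpower :: "(real \<Rightarrow> real set) \<Rightarrow> nat \<Rightarrow> real \<Rightarrow> real set" where
  "mpower F 0 = (\<lambda>x. {x})"
| "mpower F (Suc n) = mcomp F (mpower F n)"

definition usc_at :: "real set \<Rightarrow> (real \<Rightarrow> real set) \<Rightarrow> real \<Rightarrow> bool" where
  "usc_at I F x0 \<longleftrightarrow>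
     (\<forall>V. open V \<and> F x0 \<subseteq> V \<longrightarrow> (\<exists>U. open U \<and> x0 \<in> U \<and> (\<forall>x\<in>U \<inter> I. F x \<subseteq> V)))"

definition usc_on :: "real set \<Rightarrow> (real \<Rightarrow> real set) \<Rightarrow> bool" where
  "usc_on I F \<longleftrightarrow> (\<forall>x0\<in>I. usc_at I F x0)"

definition has_max :: "real set \<Rightarrow> real \<Rightarrow> bool" where
  "has_max A M \<longleftrightarrow> M \<in> A \<and> (\<forall>z\<in>A. z \<le> M)"

definition has_min :: "real set \<Rightarrow> real \<Rightarrow> bool" where
  "has_min A m \<longleftrightarrow> m \<in> A \<and> (\<forall>z\<in>A. m \<le> z)"

text \<open>
  Values need not be finite or closed, so the existence of the maxima and minima that are
  compared is part of the two definitions below.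
\<close>

definition strictly_increasing :: "real set \<Rightarrow> (real \<Rightarrow> real set) \<Rightarrow> bool" where
  "strictly_increasing I F \<longleftrightarrow>
     (\<forall>x\<in>I. \<forall>y\<in>I. x < y \<longrightarrow> (\<exists>M m. has_max (F x) M \<and> has_min (F y) m \<and> M < m))"

definition strictly_decreasing :: "real set \<Rightarrow> (real \<Rightarrow> real set) \<Rightarrow> bool" where
  "strictly_decreasing I F \<longleftrightarrow>
     (\<forall>x\<in>I. \<forall>y\<in>I. x < y \<longrightarrow> (\<exists>m M. has_min (F x) m \<and> has_max (F y) M \<and> m > M))"

definition class_F :: "real set \<Rightarrow> (real \<Rightarrow> real set) set" where
  "class_F I = {F. multifunction I F \<and> usc_on I F \<and>
                   (strictly_increasing I F \<or> strictly_decreasing I F)}"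

text \<open>
  \<open>F x\<close> has at least two elements. This is not phrased with \<^const>\<open>card\<close>, which is \<open>0\<close> on
  infinite sets.
\<close>

definition jumps :: "real set \<Rightarrow> (real \<Rightarrow> real set) \<Rightarrow> real set" where
  "jumps I F = {x \<in> I. \<exists>y\<in>F x. \<exists>z\<in>F x. y \<noteq> z}"

text \<open>
  Meaningful for \<open>F \<in> class_F I\<close> with finitely many jumps; every iterate of such an \<open>F\<close> has
  finitely many jumps, so \<^const>\<open>card\<close> is the true number of jumps.
\<close>

definition intensity :: "real set \<Rightarrow> (real \<Rightarrow> real set) \<Rightarrow> enat" where
  "intensity I F =
     (if \<exists>k. card (jumps I (mpower F k)) = card (jumps I (mpower F (Suc k)))
      then enat (LEAST k. card (jumps I (mpower F k)) = card (jumps I (mpower F (Suc k))))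
      else \<infinity>)"

definition class_F1 :: "real set \<Rightarrow> (real \<Rightarrow> real set) set" where
  "class_F1 I = {F \<in> class_F I. finite (jumps I F) \<and> intensity I F = 1}"

text \<open>
  The convention \<open>a = c 0 < c 1 < \<dots> < c m < c (m + 1) = b\<close> with \<open>c 1, \<dots>, c m\<close> the jumps
  of \<open>F\<close>; in particular all jumps lie in the open interval from \<open>a\<close> to \<open>b\<close>.
\<close>

definition jump_enumeration ::
  "real \<Rightarrow> real \<Rightarrow> (real \<Rightarrow> real set) \<Rightarrow> nat \<Rightarrow> (nat \<Rightarrow> real) \<Rightarrow> bool" where
  "jump_enumeration a b F m c \<longleftrightarrow>
     jumps {a..b} F = c ` {1..m} \<and> c 0 = a \<and> c (Suc m) = b \<and> (\<forall>i\<le>m. c i < c (Suc i))"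

definition subintervals :: "nat \<Rightarrow> (nat \<Rightarrow> real) \<Rightarrow> real set set" where
  "subintervals m c = {{c i<..<c (Suc i)} | i. i \<le> m}"

definition Lam :: "(real \<Rightarrow> real set) \<Rightarrow> nat \<Rightarrow> (nat \<Rightarrow> real) \<Rightarrow> real set set" where
  "Lam F m c = {J \<in> subintervals m c. mimage F J \<subseteq> J}"

definition decreasing_square_root_off_jumps ::
  "real set \<Rightarrow> (real \<Rightarrow> real set) \<Rightarrow> (real \<Rightarrow> real set) \<Rightarrow> bool" where
  "decreasing_square_root_off_jumps I F f \<longleftrightarrow>
     f \<in> class_F I \<and> strictly_decreasing I f \<and> (\<forall>x\<in>I - jumps I F. mpower f 2 x = F x)"

end

theory Submission
  imports Defs
begin

text \<open>
  Strict monotonicity makes distinct points have disjoint values, so \<open>f\<close> is single-valued, hence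
  continuous, off \<open>J(F)\<close>, and \<open>\<zeta>(F) = 1\<close> implies that \<open>F\<close> maps the complement of \<open>J(F)\<close> into
  itself. So does \<open>f\<close>: if \<open>f(x) = c \<in> J(F)\<close> with \<open>x \<notin> J(F)\<close>, then \<open>f\<close> is single-valued both at \<open>c\<close>
  and at \<open>f(c) = F(x)\<close>, so \<open>f\<^sup>2\<close> is continuous at \<open>c\<close>, whereas the values of \<open>F\<close> on the two sides
  of \<open>c\<close> stay apart. By connectedness \<open>f\<close> then maps every \<open>I\<^sub>i\<close> into some \<open>I\<^sub>j\<close>. If
  \<open>F(I\<^sub>i) \<subseteq> I\<^sub>i\<close>, then \<open>f(I\<^sub>j)\<close> meets \<open>I\<^sub>i\<close> and therefore lies in it, so that
  \<open>F(I\<^sub>j) \<subseteq> f(I\<^sub>i) \<subseteq> I\<^sub>j\<close>.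
\<close>

section \<open>Jumps of a strictly monotone multifunction and of its square\<close>

lemma mpower_2: "mpower F 2 = mcomp F F"
  by (simp add: numeral_2_eq_2 mcomp_def mimage_def)

lemma strictly_increasing_less:
  assumes "strictly_increasing I F" "x \<in> I" "y \<in> I" "x < y" "u \<in> F x" "v \<in> F y"
  shows "u < v"
  using assms unfolding strictly_increasing_def has_max_def has_min_def
  by (meson le_less_trans less_le_trans)

lemma strictly_decreasing_less:
  assumes "strictly_decreasing I F" "x \<in> I" "y \<in> I" "x < y" "u \<in> F x" "v \<in> F y"
  shows "v < u"
  using assms unfolding strictly_decreasing_def has_max_def has_min_def
  by (meson le_less_trans less_le_trans)

lemma class_F_disjoint_values:
  assumes "F \<in> class_F I" "x \<in> I" "y \<in> I" "x \<noteq> y" "u \<in> F x" "v \<in> F y"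
  shows "u \<noteq> v"
  using assms strictly_increasing_less[of I F x y u v] strictly_increasing_less[of I F y x v u]
    strictly_decreasing_less[of I F x y u v] strictly_decreasing_less[of I F y x v u]
  unfolding class_F_def by (cases "x < y") auto

lemma singleton_off_jumps:
  assumes "multifunction I F" "x \<in> I" "x \<notin> jumps I F"
  shows "\<exists>y\<in>I. F x = {y}"
proof -
  obtain y where "y \<in> F x" "y \<in> I"
    using assms(1,2) unfolding multifunction_def by blast
  moreover have "z = y" if "z \<in> F x" for z
    using assms(2,3) that \<open>y \<in> F x\<close> unfolding jumps_def by blast
  ultimately show ?thesis by blast
qed

text \<open>Two distinct points of \<open>F x\<close> have nonempty, disjoint values, so applying
  \<open>F\<close> once more cannot merge them: a jump survives squaring.\<close>

lemma jumps_subset_jumps_square: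
  assumes "F \<in> class_F I"
  shows "jumps I F \<subseteq> jumps I (mcomp F F)"
proof
  fix x assume "x \<in> jumps I F"
  then obtain y z where x: "x \<in> I" and yz: "y \<in> F x" "z \<in> F x" "y \<noteq> z"
    unfolding jumps_def by blast
  have mf: "multifunction I F" using assms unfolding class_F_def by blast
  then have I: "y \<in> I" "z \<in> I" using x yz unfolding multifunction_def by blast+
  then obtain u v where uv: "u \<in> F y" "v \<in> F z" using mf unfolding multifunction_def by blast
  then have "u \<noteq> v" using class_F_disjoint_values[OF assms I yz(3)] by blast
  then show "x \<in> jumps I (mcomp F F)"
    using x yz uv unfolding jumps_def mcomp_def mimage_def by blast
qed

text \<open>Intensity 1 equates the numbers of jumps of \<open>F\<close> and its square; as one
  finite jump set contains the other, they coincide. A jump as value of \<open>F\<close> at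
  \<open>x\<close> would make \<open>x\<close> a new jump of the square.\<close>

lemma class_F1_value_not_jump:
  assumes "F \<in> class_F1 I" "x \<in> I - jumps I F" "F x = {y}"
  shows "y \<notin> jumps I F"
proof
  assume y: "y \<in> jumps I F"
  have F: "F \<in> class_F I" and fin: "finite (jumps I F)" and int: "intensity I F = 1"
    using assms(1) unfolding class_F1_def by auto
  let ?P = "\<lambda>k. card (jumps I (mpower F k)) = card (jumps I (mpower F (Suc k)))"
  have ex: "\<exists>k. ?P k"
    using int unfolding intensity_def by (auto split: if_splits)
  then have "(LEAST k. ?P k) = 1"
    using int unfolding intensity_def by (simp add: one_enat_def)
  then have "?P 1" using LeastI_ex[OF ex] by simp
  moreover have "mpower F (Suc 0) = F" by (simp add: mcomp_def mimage_def)
  ultimately have card: "card (jumps I F) = card (jumps I (mcomp F F))"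
    by simp
  \<comment> \<open>\<open>card\<close> is 0 on infinite sets, so the jump set of the square is
    known to be finite only once its count is seen to be nonzero.\<close>
  have "card (jumps I F) \<noteq> 0" using y fin by auto
  then have "finite (jumps I (mcomp F F))" using card card.infinite by fastforce
  then have "jumps I F = jumps I (mcomp F F)"
    using card_subset_eq jumps_subset_jumps_square[OF F] card by blast
  moreover have "x \<in> jumps I (mcomp F F)"
    using y assms(2,3) unfolding jumps_def mcomp_def mimage_def by auto
  ultimately show False using assms(2) by blast
qed

text \<open>Since jumps survive squaring, single-valuedness passes from the square back to
  \<open>f\<close>; this carries it over from \<open>F\<close> to its root.\<close>

lemma square_singleton_imp_singleton:
  assumes "f \<in> class_F I" "x \<in> I" "mcomp f f x = {e}"
  shows "\<exists>y\<in>I. f x = {y}"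
proof (rule singleton_off_jumps)
  show "multifunction I f" using assms(1) unfolding class_F_def by blast
  show "x \<notin> jumps I f"
  proof
    assume "x \<in> jumps I f"
    then have "x \<in> jumps I (mcomp f f)" using jumps_subset_jumps_square[OF assms(1)] by blast
    then show False using assms(3) unfolding jumps_def by auto
  qed
qed (fact assms(2))

text \<open>Neighbourhoods are pulled back first at \<open>d\<close>, then at \<open>c\<close>. The
  guard \<open>f x \<subseteq> I\<close> is there because the one at \<open>d\<close> controls
  \<open>f\<close> only inside \<open>I\<close>.\<close>

lemma usc_square_singleton:
  assumes "usc_on I f" "c \<in> I" "d \<in> I" "f c = {d}" "f d = {e}" "open V" "e \<in> V"
  shows "\<exists>W. open W \<and> c \<in> W \<and> (\<forall>x\<in>W \<inter> I. f x \<subseteq> I \<longrightarrow> mcomp f f x \<subseteq> V)"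
proof -
  obtain U where U: "open U" "d \<in> U" "\<forall>x\<in>U \<inter> I. f x \<subseteq> V"
    using assms unfolding usc_on_def usc_at_def by (metis empty_subsetI insert_subset)
  obtain W where "open W" "c \<in> W" "\<forall>x\<in>W \<inter> I. f x \<subseteq> U"
    using assms U unfolding usc_on_def usc_at_def by (metis empty_subsetI insert_subset)
  then show ?thesis using U unfolding mcomp_def mimage_def by (intro exI[of _ W]) blast
qed

lemma usc_imp_continuous_on:
  assumes "usc_on I f" "S \<subseteq> I" "\<forall>x\<in>S. f x = {g x}"
  shows "continuous_on S g"
  unfolding continuous_on_topological
proof (intro ballI allI impI)
  fix x B assume "x \<in> S" "open B" "g x \<in> B"
  moreover have "usc_at I f x" using assms(1,2) \<open>x \<in> S\<close> unfolding usc_on_def by blast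
  moreover have "f x \<subseteq> B" using assms(3) \<open>x \<in> S\<close> \<open>g x \<in> B\<close> by simp
  ultimately obtain U where "open U" "x \<in> U" "\<forall>y\<in>U \<inter> I. f y \<subseteq> B"
    unfolding usc_at_def by blast
  then show "\<exists>A. open A \<and> x \<in> A \<and> (\<forall>y\<in>S. y \<in> A \<longrightarrow> g y \<in> B)"
    using assms(2,3) by (intro exI[of _ U]) blast
qed

text \<open>Supplies comparison points off the finite jump set, arbitrarily close to a given
  point.\<close>

lemma finite_avoid_interval:
  fixes c d :: real
  assumes "finite A" "c < d"
  shows "\<exists>x. c < x \<and> x < d \<and> x \<notin> A"
proof -
  have "\<not> {c<..<d} \<subseteq> A" using infinite_Ioo[OF assms(2)] finite_subset[OF _ assms(1)] by blast
  then show ?thesis by auto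
qed

section \<open>The partition of the interval by the jumps\<close>

context
  fixes a b :: real and F :: "real \<Rightarrow> real set" and m :: nat and c :: "nat \<Rightarrow> real"
  assumes enum: "jump_enumeration a b F m c"
begin

lemma jump_enumeration_mono: "i \<le> j \<Longrightarrow> j \<le> Suc m \<Longrightarrow> c i \<le> c j"
proof (induction j rule: dec_induct)
  case (step n)
  then show ?case using enum unfolding jump_enumeration_def
    by (metis Suc_leD Suc_le_mono less_eq_real_def order_trans)
qed simp

lemma subinterval_subset:
  assumes "i \<le> m"
  shows "{c i<..<c (Suc i)} \<subseteq> {a<..<b}"
  using jump_enumeration_mono[of 0 i] jump_enumeration_mono[of "Suc i" "Suc m"] assms enum
  unfolding jump_enumeration_def by auto

lemma partition_point_cases:
  assumes "i \<le> Suc m"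
  shows "c i = a \<or> c i = b \<or> c i \<in> jumps {a..b} F"
proof -
  have "i = 0 \<or> i = Suc m \<or> i \<in> {1..m}" using assms by auto
  then show ?thesis using enum unfolding jump_enumeration_def by auto
qed

lemma subinterval_no_jumps:
  assumes "i \<le> m"
  shows "{c i<..<c (Suc i)} \<inter> jumps {a..b} F = {}"
proof (rule ccontr)
  assume "\<not> ?thesis"
  then obtain x where x: "x \<in> jumps {a..b} F" "c i < x" "x < c (Suc i)" by auto
  then obtain j where "j \<in> {1..m}" "x = c j"
    using enum unfolding jump_enumeration_def by blast
  then have "j \<in> {1..m}" "c i < c j" "c j < c (Suc i)" using x by auto
  then show False
    using jump_enumeration_mono[of j i] jump_enumeration_mono[of "Suc i" j] assms
    by (cases "j \<le> i") auto
qed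

lemma subinterval_cover:
  assumes "y \<in> {a<..<b} - jumps {a..b} F"
  shows "\<exists>i\<le>m. y \<in> {c i<..<c (Suc i)}"
proof -
  \<comment> \<open>Half-open cells make the induction on \<open>n\<close> go through; the right
    endpoint is excluded afterwards, being \<open>a\<close>, \<open>b\<close> or a jump.\<close>
  have *: "\<exists>i<n. c i < y \<and> y \<le> c (Suc i)" if "y \<le> c n" for n
    using that
  proof (induction n)
    case 0 then show ?case using assms enum unfolding jump_enumeration_def by auto
  next
    case (Suc n) then show ?case by (cases "y \<le> c n") (auto intro: less_SucI)
  qed
  have "y \<le> c (Suc m)" using assms enum unfolding jump_enumeration_def by auto
  from *[OF this] obtain i where i: "i < Suc m" "c i < y" "y \<le> c (Suc i)" by blast
  moreover have "y \<noteq> c (Suc i)" using partition_point_cases[of "Suc i"] i assms by auto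
  ultimately show ?thesis by (intro exI[of _ i]) auto
qed

text \<open>The endpoints of a cell are jumps or endpoints of the whole interval, hence outside
  \<open>S\<close>; a connected set cannot leave the cell without crossing one of them.\<close>

lemma connected_subset_subinterval:
  assumes "connected S" "S \<subseteq> {a<..<b} - jumps {a..b} F" "i \<le> m"
    and "x \<in> S" "x \<in> {c i<..<c (Suc i)}"
  shows "S \<subseteq> {c i<..<c (Suc i)}"
proof
  fix y assume y: "y \<in> S"
  have not_in: "c i \<notin> S" "c (Suc i) \<notin> S"
    using partition_point_cases[of i] partition_point_cases[of "Suc i"] assms(2,3) by auto
  show "y \<in> {c i<..<c (Suc i)}"
  proof (rule ccontr)
    assume "y \<notin> {c i<..<c (Suc i)}"
    then consider "y \<le> c i" | "c (Suc i) \<le> y" by force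
    then show False
      using connectedD_interval[OF assms(1) y assms(4), of "c i"]
        connectedD_interval[OF assms(1) assms(4) y, of "c (Suc i)"] assms(5) not_in
      by cases auto
  qed
qed

end

section \<open>Values of the root avoid the jumps\<close>

lemma square_root_value_not_jump:
  assumes F: "F \<in> class_F1 {a..b}" "strictly_increasing {a..b} F"
    and interior: "jumps {a..b} F \<subseteq> {a<..<b}"
    and f: "f \<in> class_F {a..b}" "\<forall>x\<in>{a..b} - jumps {a..b} F. mcomp f f x = F x"
    and x: "x \<in> {a..b} - jumps {a..b} F" "f x = {d}"
  shows "d \<notin> jumps {a..b} F"
proof
  let ?J = "jumps {a..b} F"
  assume d: "d \<in> ?J"
  then have dI: "a < d" "d < b" using interior by auto
  have mf: "multifunction {a..b} f" "usc_on {a..b} f" and mF: "multifunction {a..b} F"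
    and fin: "finite ?J"
    using F f unfolding class_F1_def class_F_def by auto
  obtain e where e: "e \<in> {a..b}" "F x = {e}" using singleton_off_jumps[OF mF] x by blast
  have eJ: "e \<notin> ?J" using class_F1_value_not_jump[OF F(1) x(1) e(2)] .
  have "mcomp f f x = {e}" using f(2) x(1) e(2) by metis
  then have fd: "f d = {e}" unfolding mcomp_def mimage_def x(2) by simp
  obtain w where w: "F e = {w}" using singleton_off_jumps[OF mF e(1) eJ] by blast
  have "mcomp f f e = {w}" using f(2) e(1) eJ w by (metis DiffI)
  then obtain v where v: "f e = {v}"
    using square_singleton_imp_singleton[OF f(1) e(1)] by blast
  obtain y z where yz: "y \<in> F d" "z \<in> F d" "y < z"
    using d unfolding jumps_def by (auto simp: neq_iff)
  \<comment> \<open>The length of \<open>?V\<close> is exactly the gap \<open>z - y\<close> inside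
    \<open>F d\<close>, so \<open>?V\<close> cannot contain a value below \<open>y\<close> together
    with one above \<open>z\<close>.\<close>
  let ?V = "{v - (z - y) / 2 <..< v + (z - y) / 2}"
  obtain W where W: "open W" "d \<in> W" "\<forall>x\<in>W \<inter> {a..b}. f x \<subseteq> {a..b} \<longrightarrow> mcomp f f x \<subseteq> ?V"
    using usc_square_singleton[OF mf(2) _ e(1) fd v, of ?V] dI yz by auto
  have FV: "F t \<subseteq> ?V" if "t \<in> W \<inter> {a..b} - ?J" for t
  proof -
    have "mcomp f f t \<subseteq> ?V" using W(3) that mf(1) unfolding multifunction_def by blast
    then show ?thesis using f(2) that by auto
  qed
  obtain r where r: "r > 0" "\<forall>t. dist t d < r \<longrightarrow> t \<in> W"
    using W(1,2) unfolding open_dist by blast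
  \<comment> \<open>Non-jumps \<open>s\<close> and \<open>t\<close> on either side of
    \<open>d\<close> exist because \<open>d\<close> is interior; their values under \<open>F\<close>
    straddle the gap but both lie in \<open>?V\<close>.\<close>
  obtain s where s: "max a (d - r) < s" "s < d" "s \<notin> ?J"
    using finite_avoid_interval[OF fin, of "max a (d - r)" d] dI r by auto
  obtain t where t: "d < t" "t < min b (d + r)" "t \<notin> ?J"
    using finite_avoid_interval[OF fin, of d "min b (d + r)"] dI r by auto
  have st: "s \<in> W \<inter> {a..b} - ?J" "t \<in> W \<inter> {a..b} - ?J"
    using s t r dI by (auto simp: dist_real_def)
  obtain p where p: "F s = {p}" using singleton_off_jumps[OF mF] st by blast
  obtain q where q: "F t = {q}" using singleton_off_jumps[OF mF] st by blast
  have "p < y" "z < q"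
    using strictly_increasing_less[OF F(2), of s d p y]
      strictly_increasing_less[OF F(2), of d t z q] st s t p q yz dI by auto
  moreover have "p \<in> ?V" "q \<in> ?V" using FV st p q by blast+
  ultimately show False by (auto simp: field_simps)
qed

theorem theorem4p1:
  fixes a b :: real and F f :: "real \<Rightarrow> real set" and m :: nat and c :: "nat \<Rightarrow> real"
  assumes "a < b"
    and "F \<in> class_F1 {a..b}"
    and "strictly_increasing {a..b} F"
    and "jump_enumeration a b F m c"
    and "decreasing_square_root_off_jumps {a..b} F f"
  defines "D \<equiv> \<Union> (Lam F m c)"
  shows "mimage f D \<subseteq> D \<and>
    (\<exists>g :: real \<Rightarrow> real. (\<forall>x\<in>D. f x = {g x}) \<and> g ` D \<subseteq> D \<and>
       strict_antimono_on D g \<and> (\<forall>x\<in>D. F x = {g (g x)}))"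
proof -
  let ?I = "{a..b}" and ?J = "jumps {a..b} F" and ?K = "\<lambda>i. {c i<..<c (Suc i)}"
  let ?S = "{a<..<b} - ?J"
  have f: "f \<in> class_F ?I" "strictly_decreasing ?I f"
    and root: "\<forall>x\<in>?I - ?J. mcomp f f x = F x"
    using assms(5) unfolding decreasing_square_root_off_jumps_def mpower_2 by auto
  have mF: "multifunction ?I F" and usc: "usc_on ?I f"
    using assms(2) f(1) unfolding class_F1_def class_F_def by auto
  have interior: "?J \<subseteq> {a<..<b}"
  proof
    fix x assume "x \<in> ?J"
    then obtain i where i: "i \<in> {1..m}" "x = c i"
      using assms(4) unfolding jump_enumeration_def by auto
    moreover have "c k < c (Suc k)" if "k \<le> m" for k
      using assms(4) that unfolding jump_enumeration_def by blast
    from this[of "i - 1"] this[of i] have "c (i - 1) < c i" "c i < c (Suc i)" using i(1) by auto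
    moreover have "a \<le> c (i - 1)" "c (Suc i) \<le> b"
      using jump_enumeration_mono[OF assms(4), of 0 "i - 1"]
        jump_enumeration_mono[OF assms(4), of "Suc i" "Suc m"] i(1) assms(4)
      unfolding jump_enumeration_def by auto
    ultimately show "x \<in> {a<..<b}" by auto
  qed
  \<comment> \<open>The value of \<open>g\<close> is meaningful only where \<open>f x\<close> is a
    singleton, in particular off the jumps.\<close>
  define g where "g x = the_elem (f x)" for x
  have fg: "f x = {g x}" "g x \<in> ?I - ?J" if x: "x \<in> ?I - ?J" for x
  proof -
    obtain e where "F x = {e}" using singleton_off_jumps[OF mF] x by blast
    then have "mcomp f f x = {e}" using root x by metis
    then obtain y where y: "y \<in> ?I" "f x = {y}"
      using square_singleton_imp_singleton[OF f(1)] x by blast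
    then show "f x = {g x}" by (simp add: g_def)
    show "g x \<in> ?I - ?J"
      using square_root_value_not_jump[OF assms(2,3) interior f(1) root x y(2)] y
      by (simp add: g_def)
  qed
  have anti: "g y < g x" if "x \<in> ?I - ?J" "y \<in> ?I - ?J" "x < y" for x y
    using strictly_decreasing_less[OF f(2), of x y "g x" "g y"] fg that by simp
  have fin: "finite ?J" using assms(2) unfolding class_F1_def by blast
  \<comment> \<open>The values at non-jumps on both sides of \<open>x\<close> squeeze
    \<open>g x\<close> strictly, which rules out \<open>a\<close> and \<open>b\<close>.\<close>
  have gS: "g x \<in> ?S" if x: "x \<in> ?S" for x
  proof -
    obtain y where y: "a < y" "y < x" "y \<notin> ?J"
      using finite_avoid_interval[OF fin, of a x] x by auto
    obtain z where z: "x < z" "z < b" "z \<notin> ?J"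
      using finite_avoid_interval[OF fin, of x b] x by auto
    have "g x < g y" "g z < g x" using anti[of y x] anti[of x z] x y z by auto
    moreover have "g y \<in> ?I" "g z \<in> ?I" "g x \<in> ?I - ?J"
      using fg(2)[of y] fg(2)[of z] fg(2)[of x] x y z by auto
    ultimately show ?thesis by auto
  qed
  have Fg: "F x = {g (g x)}" if "x \<in> ?I - ?J" for x
  proof -
    have "mcomp f f x = {g (g x)}"
      unfolding mcomp_def mimage_def fg(1)[OF that] by (simp add: fg(1)[OF fg(2)[OF that]])
    then show ?thesis using root that by metis
  qed
  have KS: "?K i \<subseteq> ?S" if "i \<le> m" for i
    using subinterval_subset[OF assms(4) that] subinterval_no_jumps[OF assms(4) that] by blast
  have SI: "?S \<subseteq> ?I - ?J" by auto
  have conn: "connected (g ` ?K i)" "g ` ?K i \<subseteq> ?S" if "i \<le> m" for i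
  proof -
    have sub: "?K i \<subseteq> ?I - ?J" using KS[OF that] SI by (rule order_trans)
    have "continuous_on (?K i) g"
    proof (rule usc_imp_continuous_on[OF usc])
      show "?K i \<subseteq> ?I" using sub by blast
      show "\<forall>x\<in>?K i. f x = {g x}" using sub fg(1) by (metis subsetD)
    qed
    then show "connected (g ` ?K i)" by (rule connected_continuous_image) simp
    show "g ` ?K i \<subseteq> ?S" using gS subsetD[OF KS[OF that]] by (metis image_subsetI)
  qed
  have Lam_iff: "?K i \<in> Lam F m c \<longleftrightarrow> (\<forall>x\<in>?K i. g (g x) \<in> ?K i)" if "i \<le> m" for i
  proof -
    have "F x = {g (g x)}" if "x \<in> ?K i" for x
      using subsetD[OF SI subsetD[OF KS[OF \<open>i \<le> m\<close>] that]] by (rule Fg)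
    moreover have "?K i \<in> subintervals m c" using that unfolding subintervals_def by blast
    ultimately show ?thesis unfolding Lam_def mimage_def by auto
  qed
  have D_iff: "x \<in> D \<longleftrightarrow> (\<exists>i\<le>m. x \<in> ?K i \<and> ?K i \<in> Lam F m c)" for x
    unfolding D_def Lam_def subintervals_def by blast
  have DS: "x \<in> ?I - ?J" if x: "x \<in> D" for x
  proof -
    obtain i where "i \<le> m" "x \<in> ?K i" using D_iff[of x] x by blast
    then show ?thesis using KS[of i] SI by blast
  qed
  have gD: "g x \<in> D" if x: "x \<in> D" for x
  proof -
    obtain i where i: "i \<le> m" "x \<in> ?K i" "?K i \<in> Lam F m c" using D_iff[of x] x by blast
    obtain j where j: "j \<le> m" "g x \<in> ?K j"
      using subinterval_cover[OF assms(4), of "g x"] gS[of x] KS[OF i(1)] i(2) by blast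
    have ij: "g ` ?K i \<subseteq> ?K j"
      using connected_subset_subinterval[OF assms(4) conn[OF i(1)] j(1) imageI[OF i(2)] j(2)] .
    \<comment> \<open>The point \<open>g x\<close> of \<open>?K j\<close> returns to
      \<open>?K i\<close>, and this single point fixes the cell that receives the whole image of
      \<open>?K j\<close>.\<close>
    have "g (g x) \<in> ?K i" using i Lam_iff[OF i(1)] by metis
    then have ji: "g ` ?K j \<subseteq> ?K i"
      using connected_subset_subinterval[OF assms(4) conn[OF j(1)] i(1) imageI[OF j(2)]] by blast
    have "\<forall>y\<in>?K j. g (g y) \<in> ?K j" using ij ji by (metis image_subset_iff)
    then have "?K j \<in> Lam F m c" using Lam_iff[OF j(1)] by metis
    then show ?thesis using D_iff j by metis
  qed
  have "strict_antimono_on D g"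
    by (rule monotone_onI) (rule anti[OF DS DS])
  moreover have "mimage f D \<subseteq> D"
    unfolding mimage_def by (simp add: UN_subset_iff fg(1)[OF DS] gD)
  moreover have "g ` D \<subseteq> D" using gD by (rule image_subsetI)
  ultimately show ?thesis using fg(1)[OF DS] Fg[OF DS] by metis
qed

end
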